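(* If $\mathcal{V}$ is a congruence distributive variety, then $\mathcal{V}$ is $n$-commutator neutral for all $n\geq 2$.
   Context: Higher commutator. For congruences $\alpha_1,\dots,\alpha_n,\delta$ of an algebra $\mathbf{A}$ ($n\ge 2$), $C(\alpha_1,\dots,\alpha_n;\delta)$ holds if for all polynomials $f(\mathbf{x}_1,\dots,\mathbf{x}_n)$ of $\mathbf A$ in $n$ blocks of variables and all tuples with $\mathbf{a}_i\equiv_{\alpha_i}\mathbf{b}_i$ (coordinatewise, $i\le n$): if $f(\mathbf{z}_1,\dots,\mathbf{z}_{n-1},\mathbf{a}_n)\equiv_\delta f(\mathbf{z}_1,\dots,\mathbf{z}_{n-1},\mathbf{b}_n)$ for every $(\mathbf{z}_1,\dots,\mathbf{z}_{n-1})\in\prod_{i<n}\{\mathbf{a}_i,\mathbf{b}_i\}\setminus\{(\mathbf{b}_1,\dots,\mathbf{b}_{n-1})\}$, then $f(\mathbf{b}_1,\dots,\mathbf{b}_{n-1},\mathbf{a}_n)\equiv_\delta f(\mathbf{b}_1,\dots,\mathbf{b}_{n-1},\mathbf{b}_n)$. $[\alpha_1,\dots,\alpha_n]$ is the least $\delta$ with $C(\alpha_1,\dots,\alpha_n;\delta)$. Neutrality. The $n$-commutator is neutral in $\mathbf{A}$ if $[\alpha_1,\dots,\alpha_n]=\alpha_1\wedge\cdots\wedge\alpha_n$ for all $\alpha_1,\dots,\alpha_n\in\mathrm{Con}\,\mathbf{A}$. A variety is $n$-commutator neutral if the $n$-commutator is neutral in each of its algebras. *)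

theory Defs
  imports Main
begin

section \<open>Terms and algebras\<close>

text \<open>A finitary signature assigns an arity to each of its operation symbols; \<open>sig f = None\<close> means
  that \<open>f\<close> is not a symbol of the signature, so that every signature, including the empty one, is
  available.\<close>

type_synonym 'f signature = "'f \<Rightarrow> nat option"

datatype ('f, 'v) tm = Var 'v | Op 'f "('f, 'v) tm list"

inductive_set tms :: "'f signature \<Rightarrow> 'v set \<Rightarrow> ('f, 'v) tm set"
  for sig :: "'f signature" and X :: "'v set" where
  Var: "x \<in> X \<Longrightarrow> Var x \<in> tms sig X"
| Op: "sig f = Some (length ts) \<Longrightarrow> (\<And>t. t \<in> set ts \<Longrightarrow> t \<in> tms sig X) \<Longrightarrow> Op f ts \<in> tms sig X"

record ('f, 'a) algebra =
  carrier :: "'a set"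
  interp :: "'f \<Rightarrow> 'a list \<Rightarrow> 'a"

definition is_algebra :: "'f signature \<Rightarrow> ('f, 'a) algebra \<Rightarrow> bool" where
  "is_algebra sig A \<longleftrightarrow> carrier A \<noteq> {} \<and>
     (\<forall>f n xs. sig f = Some n \<and> length xs = n \<and> set xs \<subseteq> carrier A \<longrightarrow> interp A f xs \<in> carrier A)"

fun eval :: "('f, 'a) algebra \<Rightarrow> ('v \<Rightarrow> 'a) \<Rightarrow> ('f, 'v) tm \<Rightarrow> 'a" where
  "eval A \<rho> (Var x) = \<rho> x"
| "eval A \<rho> (Op f ts) = interp A f (map (eval A \<rho>) ts)"


section \<open>Varieties\<close>

definition identities :: "'f signature \<Rightarrow> (('f, nat) tm \<times> ('f, nat) tm) set" where
  "identities sig = tms sig UNIV \<times> tms sig UNIV"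

text \<open>The variety defined by a set \<open>E\<close> of identities, restricted to the algebras whose carrier is
  contained in the type \<open>'a\<close>. The proper class of all models of \<open>E\<close> is represented by the instances of
  this constant at all types \<open>'a\<close>. A hypothesis on all algebras of a variety cannot quantify over
  types, so it has to be imposed at one type \<open>'u\<close>; it carries the intended content only if \<open>'u\<close> is
  large enough to contain the terms, and hence a copy of each countably generated free algebra of
  the variety. (At a two-element type, for instance, every algebra is congruence distributive.)\<close>

definition variety ::
  "'f signature \<Rightarrow> (('f, nat) tm \<times> ('f, nat) tm) set \<Rightarrow> ('f, 'a) algebra set" where
  "variety sig E = {A. is_algebra sig A \<and>
     (\<forall>(s, t) \<in> E. \<forall>\<rho>. range \<rho> \<subseteq> carrier A \<longrightarrow> eval A \<rho> s = eval A \<rho> t)}"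


section \<open>Congruences\<close>

definition Con :: "'f signature \<Rightarrow> ('f, 'a) algebra \<Rightarrow> 'a rel set" where
  "Con sig A = {\<theta>. equiv (carrier A) \<theta> \<and>
     (\<forall>f xs ys. sig f = Some (length xs) \<and> list_all2 (\<lambda>x y. (x, y) \<in> \<theta>) xs ys
        \<longrightarrow> (interp A f xs, interp A f ys) \<in> \<theta>)}"

text \<open>Meets in the congruence lattice are intersections.\<close>

definition con_join :: "'f signature \<Rightarrow> ('f, 'a) algebra \<Rightarrow> 'a rel \<Rightarrow> 'a rel \<Rightarrow> 'a rel" where
  "con_join sig A \<beta> \<gamma> = \<Inter> {\<theta> \<in> Con sig A. \<beta> \<union> \<gamma> \<subseteq> \<theta>}"

definition congruence_distributive :: "'f signature \<Rightarrow> ('f, 'a) algebra \<Rightarrow> bool" where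
  "congruence_distributive sig A \<longleftrightarrow>
     (\<forall>\<alpha> \<in> Con sig A. \<forall>\<beta> \<in> Con sig A. \<forall>\<gamma> \<in> Con sig A.
        \<alpha> \<inter> con_join sig A \<beta> \<gamma> = con_join sig A (\<alpha> \<inter> \<beta>) (\<alpha> \<inter> \<gamma>))"


section \<open>The higher commutator\<close>

text \<open>Polynomials of \<open>A\<close> in \<open>n\<close> blocks of variables (indexed from \<open>0\<close>), the \<open>i\<close>-th of length \<open>k i\<close>:
  terms in the variables \<open>Inl (i, j)\<close>, the \<open>j\<close>-th variable of block \<open>i\<close>, and in the constants
  \<open>Inr c\<close> for \<open>c\<close> in \<open>A\<close>.\<close>

definition polynomials ::
  "'f signature \<Rightarrow> ('f, 'a) algebra \<Rightarrow> nat \<Rightarrow> (nat \<Rightarrow> nat) \<Rightarrow> ('f, (nat \<times> nat) + 'a) tm set" where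
  "polynomials sig A n k = tms sig (Inl ` {(i, j). i < n \<and> j < k i} \<union> Inr ` carrier A)"

definition poly_value ::
  "('f, 'a) algebra \<Rightarrow> ('f, (nat \<times> nat) + 'a) tm \<Rightarrow> (nat \<Rightarrow> 'a list) \<Rightarrow> 'a" where
  "poly_value A p z = eval A (case_sum (\<lambda>(i, j). z i ! j) (\<lambda>c. c)) p"

text \<open>The vertex of the cube \<open>\<Prod>i. {a i, b i}\<close> that takes \<open>b i\<close> for \<open>i \<in> S\<close> and \<open>a i\<close> otherwise.\<close>

definition vertex :: "(nat \<Rightarrow> 'x) \<Rightarrow> (nat \<Rightarrow> 'x) \<Rightarrow> nat set \<Rightarrow> nat \<Rightarrow> 'x" where
  "vertex a b S = (\<lambda>i. if i \<in> S then b i else a i)"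

text \<open>The condition \<open>C(\<alpha>\<^sub>1, \<dots>, \<alpha>\<^sub>n; \<delta>)\<close>, where the list \<open>\<alpha>s\<close> has length \<open>n\<close> and the last block has
  index \<open>n - 1\<close>. The vertices of the cube spanned by the first \<open>n - 1\<close> blocks are indexed by the sets
  of blocks in which \<open>b\<close> is chosen, and the excluded one is the vertex at which every choice is \<open>b\<close>.
  Vertices are distinguished as choices, not as tuples: read as sets of tuples,
  \<open>\<Prod>i<n-1. {a i, b i} - {(b 0, \<dots>, b (n-2))}\<close> would be empty when \<open>a\<close> and \<open>b\<close> agree on these blocks,
  and \<open>C\<close> would then force \<open>\<alpha>\<^sub>n \<subseteq> \<delta>\<close>.\<close>

definition centralizes ::
  "'f signature \<Rightarrow> ('f, 'a) algebra \<Rightarrow> 'a rel list \<Rightarrow> 'a rel \<Rightarrow> bool" where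
  "centralizes sig A \<alpha>s \<delta> \<longleftrightarrow>
     (let n = length \<alpha>s in
      \<forall>a b. (\<forall>i<n. list_all2 (\<lambda>x y. (x, y) \<in> \<alpha>s ! i) (a i) (b i)) \<longrightarrow>
        (\<forall>p \<in> polynomials sig A n (\<lambda>i. length (a i)).
           (\<forall>S. S \<subset> {..<n - 1} \<longrightarrow>
              (poly_value A p (vertex a b S),
               poly_value A p (vertex a b (insert (n - 1) S))) \<in> \<delta>)
           \<longrightarrow> (poly_value A p (vertex a b {..<n - 1}),
                poly_value A p (vertex a b (insert (n - 1) {..<n - 1}))) \<in> \<delta>))"

definition higher_commutator ::
  "'f signature \<Rightarrow> ('f, 'a) algebra \<Rightarrow> 'a rel list \<Rightarrow> 'a rel" where
  "higher_commutator sig A \<alpha>s = (LEAST \<delta>. \<delta> \<in> Con sig A \<and> centralizes sig A \<alpha>s \<delta>)"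

lemma Full_in_Con:
  assumes "is_algebra sig A"
  shows "carrier A \<times> carrier A \<in> Con sig A"
proof -
  have "(interp A f xs, interp A f ys) \<in> carrier A \<times> carrier A"
    if "sig f = Some (length xs)" "list_all2 (\<lambda>x y. (x, y) \<in> carrier A \<times> carrier A) xs ys" for f xs ys
  proof -
    have "length ys = length xs" "set xs \<subseteq> carrier A" "set ys \<subseteq> carrier A"
      using that(2) by (auto simp: list_all2_conv_all_nth in_set_conv_nth)
    then show ?thesis using assms that(1) by (simp add: is_algebra_def)
  qed
  then show ?thesis by (auto simp: Con_def equiv_def refl_on_def sym_def trans_def)
qed

lemma Inter_in_Con:
  assumes "D \<subseteq> Con sig A" "D \<noteq> {}"
  shows "\<Inter> D \<in> Con sig A"
proof -
  have eq: "equiv (carrier A) \<theta>" if "\<theta> \<in> D" for \<theta>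
    using assms that by (auto simp: Con_def)
  have "equiv (carrier A) (\<Inter> D)"
  proof (rule equivI)
    show "\<Inter> D \<subseteq> carrier A \<times> carrier A"
      using assms(2) eq by (fastforce simp: equiv_def)
    show "refl_on (carrier A) (\<Inter> D)"
      using eq by (auto simp: equiv_def refl_on_def)
    show "sym (\<Inter> D)"
      using eq by (auto simp: equiv_def intro!: symI dest: symD)
    show "trans (\<Inter> D)"
      using eq unfolding equiv_def trans_def by blast
  qed
  moreover have "(interp A f xs, interp A f ys) \<in> \<theta>"
    if "\<theta> \<in> D" "sig f = Some (length xs)" "list_all2 (\<lambda>x y. (x, y) \<in> \<Inter> D) xs ys" for \<theta> f xs ys
  proof -
    have "list_all2 (\<lambda>x y. (x, y) \<in> \<theta>) xs ys"
      using that(3) by (rule list_all2_mono) (use that(1) in auto)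
    then show ?thesis using that assms(1) by (auto simp: Con_def)
  qed
  ultimately show ?thesis by (auto simp: Con_def)
qed

lemma eval_in_carrier:
  assumes "is_algebra sig A" "t \<in> tms sig X" "\<And>x. x \<in> X \<Longrightarrow> \<rho> x \<in> carrier A"
  shows "eval A \<rho> t \<in> carrier A"
  using assms(2)
proof induction
  case (Var x)
  then show ?case using assms(3) by simp
next
  case (Op f ts)
  then have "set (map (eval A \<rho>) ts) \<subseteq> carrier A" by auto
  then show ?case using assms(1) Op(1) by (simp add: is_algebra_def)
qed

lemma poly_value_in_carrier:
  assumes "is_algebra sig A" "p \<in> polynomials sig A n k"
    and "\<And>i. i < n \<Longrightarrow> length (z i) = k i \<and> set (z i) \<subseteq> carrier A"
  shows "poly_value A p z \<in> carrier A"
  unfolding poly_value_def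
  by (rule eval_in_carrier[OF assms(1) assms(2)[unfolded polynomials_def]])
     (use assms(3) in \<open>auto simp: subset_iff\<close>)

lemma centralizes_Full:
  assumes "is_algebra sig A" "set \<alpha>s \<subseteq> Con sig A"
  shows "centralizes sig A \<alpha>s (carrier A \<times> carrier A)"
proof -
  have "poly_value A p (vertex a b S) \<in> carrier A"
    if ab: "\<forall>i<length \<alpha>s. list_all2 (\<lambda>x y. (x, y) \<in> \<alpha>s ! i) (a i) (b i)"
      and p: "p \<in> polynomials sig A (length \<alpha>s) (\<lambda>i. length (a i))" for a b p S
  proof (rule poly_value_in_carrier[OF assms(1) p])
    fix i assume i: "i < length \<alpha>s"
    then have "\<alpha>s ! i \<subseteq> carrier A \<times> carrier A"
      using subsetD[OF assms(2) nth_mem[OF i]] by (simp add: Con_def equiv_def)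
    then show "length (vertex a b S i) = length (a i) \<and> set (vertex a b S i) \<subseteq> carrier A"
      using ab[rule_format, OF i]
      by (fastforce simp: vertex_def list_all2_conv_all_nth in_set_conv_nth)
  qed
  then show ?thesis by (auto simp: centralizes_def Let_def)
qed

lemma centralizes_Inter:
  assumes "\<And>\<delta>. \<delta> \<in> D \<Longrightarrow> centralizes sig A \<alpha>s \<delta>"
  shows "centralizes sig A \<alpha>s (\<Inter> D)"
  unfolding centralizes_def Let_def
proof (intro allI impI ballI InterI)
  fix a b p \<delta>
  assume "\<forall>i<length \<alpha>s. list_all2 (\<lambda>x y. (x, y) \<in> \<alpha>s ! i) (a i) (b i)"
    and "p \<in> polynomials sig A (length \<alpha>s) (\<lambda>i. length (a i))"
    and "\<forall>S\<subset>{..<length \<alpha>s - 1}. (poly_value A p (vertex a b S),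
           poly_value A p (vertex a b (insert (length \<alpha>s - 1) S))) \<in> \<Inter> D"
    and "\<delta> \<in> D"
  then show "(poly_value A p (vertex a b {..<length \<alpha>s - 1}),
      poly_value A p (vertex a b (insert (length \<alpha>s - 1) {..<length \<alpha>s - 1}))) \<in> \<delta>"
    using assms[of \<delta>] unfolding centralizes_def Let_def by blast
qed

text \<open>The least congruence in \<open>higher_commutator\<close> exists.\<close>

lemma higher_commutator_is_least:
  assumes "is_algebra sig A" "set \<alpha>s \<subseteq> Con sig A"
  shows "higher_commutator sig A \<alpha>s \<in> Con sig A"
    and "centralizes sig A \<alpha>s (higher_commutator sig A \<alpha>s)"
    and "\<lbrakk>\<delta> \<in> Con sig A; centralizes sig A \<alpha>s \<delta>\<rbrakk> \<Longrightarrow> higher_commutator sig A \<alpha>s \<subseteq> \<delta>"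
proof -
  define D where "D = {\<delta> \<in> Con sig A. centralizes sig A \<alpha>s \<delta>}"
  have "D \<noteq> {}"
    using Full_in_Con[OF assms(1)] centralizes_Full[OF assms] by (auto simp: D_def)
  then have D: "\<Inter> D \<in> Con sig A" "centralizes sig A \<alpha>s (\<Inter> D)"
    by (auto simp: D_def intro!: Inter_in_Con centralizes_Inter)
  have "higher_commutator sig A \<alpha>s = \<Inter> D"
    unfolding higher_commutator_def by (rule Least_equality) (use D in \<open>auto simp: D_def\<close>)
  with D show "higher_commutator sig A \<alpha>s \<in> Con sig A"
    and "centralizes sig A \<alpha>s (higher_commutator sig A \<alpha>s)"
    and "\<lbrakk>\<delta> \<in> Con sig A; centralizes sig A \<alpha>s \<delta>\<rbrakk> \<Longrightarrow> higher_commutator sig A \<alpha>s \<subseteq> \<delta>"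
    by (auto simp: D_def)
qed

definition commutator_neutral :: "'f signature \<Rightarrow> nat \<Rightarrow> ('f, 'a) algebra \<Rightarrow> bool" where
  "commutator_neutral sig n A \<longleftrightarrow>
     (\<forall>\<alpha>s. length \<alpha>s = n \<and> set \<alpha>s \<subseteq> Con sig A \<longrightarrow> higher_commutator sig A \<alpha>s = \<Inter> (set \<alpha>s))"

end

theory Submission
  imports Defs
begin

text \<open>That the commutator lies below the meet is a general fact about the term condition: the top
  edge of a cube is related, modulo each \<open>\<alpha>\<^sub>i\<close>, to a parallel edge that is collapsed by hypothesis
  (lemma \<open>centralizes_Inter_set\<close>).

  The converse rests on Jonsson terms, ternary terms \<open>d\<^sub>0 = x, \<dots>, d\<^sub>m = z\<close> with \<open>d\<^sub>i(x, y, x) = x\<close>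
  such that \<open>d\<^sub>i\<close> and \<open>d\<^sub>i\<^sub>+\<^sub>1\<close> agree at \<open>(x, x, z)\<close> or at \<open>(x, z, z)\<close>. Let \<open>\<delta>\<close> satisfy the term condition
  and let \<open>(u, v)\<close> lie in every \<open>\<alpha>\<^sub>i\<close>. Then \<open>\<delta>\<close> contains the top edge of every \<open>n\<close>-dimensional cube
  that is obtained by applying a polynomial to the vertices of \<open>{u, v}\<^sup>n\<close> and whose other edges in the
  last direction are trivial; call such a cube flat. The pair \<open>(u, v)\<close> is the top edge of
  the flat cube \<open>z\<^sub>1\<close> of dimension 1. The idea is to show that if \<open>\<delta>\<close> contains the top edges of the flat cubes of dimension
  \<open>k + 1\<close>, it also contains those of dimension \<open>k\<close>; going down from \<open>n\<close> to 1 gives \<open>(u, v) \<in> \<delta>\<close>.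

  Let \<open>F(z\<^sub>1, \<dots>, z\<^sub>k)\<close> be flat with top edge \<open>(c, e)\<close>. For each Jonsson term \<open>d\<close> the polynomial
  \<open>G(z\<^sub>1, \<dots>, z\<^sub>k\<^sub>+\<^sub>1) = d(F(z', u), F(z', z\<^sub>k\<^sub>+\<^sub>1), F(z', z\<^sub>k))\<close>, where \<open>z' = (z\<^sub>1, \<dots>, z\<^sub>k\<^sub>-\<^sub>1)\<close>, is flat again:
  if \<open>z'\<close> is not the top vertex, the three arguments agree, and if \<open>z\<^sub>k = u\<close>, the outer two agree. Its top
  edge is \<open>(d(c, c, e), d(c, e, e))\<close> (lemma \<open>raise_dimension\<close>). Hence \<open>\<delta>\<close> contains these pairs for all
  Jonsson terms, and the identities between consecutive terms link them to a chain from \<open>c\<close> to \<open>e\<close>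
  (lemma \<open>Jonsson_link_connects\<close>).

  Distributivity is only given for algebras on the type \<open>'u\<close>, so the Jonsson terms for \<open>A\<close> are found in
  a copy on \<open>'u\<close> of the free algebra on countably many generators in the variety generated by \<open>A\<close>: the
  terms modulo the identities of \<open>A\<close>. Defining it by validity in \<open>A\<close> makes a calculus of equational
  derivations from \<open>E\<close> unnecessary.\<close>

section \<open>Substitution\<close>

fun tm_subst :: "('v \<Rightarrow> ('f, 'w) tm) \<Rightarrow> ('f, 'v) tm \<Rightarrow> ('f, 'w) tm" where
  "tm_subst \<sigma> (Var x) = \<sigma> x"
| "tm_subst \<sigma> (Op f ts) = Op f (map (tm_subst \<sigma>) ts)"

lemma eval_tm_subst: "eval A \<rho> (tm_subst \<sigma> t) = eval A (\<lambda>x. eval A \<rho> (\<sigma> x)) t"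
  by (induction t) (simp_all add: comp_def cong: map_cong)

lemma tm_subst_in_tms:
  assumes "t \<in> tms sig X" "\<And>x. x \<in> X \<Longrightarrow> \<sigma> x \<in> tms sig Y"
  shows "tm_subst \<sigma> t \<in> tms sig Y"
  using assms(1)
proof induction
  case (Op f ts)
  then show ?case by (auto intro!: tms.Op)
qed (simp add: assms(2))

lemma eval_cong_tms:
  assumes "t \<in> tms sig X" "\<And>x. x \<in> X \<Longrightarrow> \<rho> x = \<rho>' x"
  shows "eval A \<rho> t = eval A \<rho>' t"
  using assms(1)
proof induction
  case (Op f ts)
  then have "map (eval A \<rho>) ts = map (eval A \<rho>') ts" by simp
  then show ?case by (simp only: eval.simps)
qed (simp add: assms(2))


section \<open>Congruences and their joins\<close>

lemma Con_equiv: "\<theta> \<in> Con sig A \<Longrightarrow> equiv (carrier A) \<theta>"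
  by (simp add: Con_def)

lemma Con_interp:
  "\<lbrakk>\<theta> \<in> Con sig A; sig f = Some (length xs); list_all2 (\<lambda>x y. (x, y) \<in> \<theta>) xs ys\<rbrakk>
    \<Longrightarrow> (interp A f xs, interp A f ys) \<in> \<theta>"
  by (simp add: Con_def)

lemma Con_refl: "\<lbrakk>\<theta> \<in> Con sig A; x \<in> carrier A\<rbrakk> \<Longrightarrow> (x, x) \<in> \<theta>"
  by (meson Con_equiv equiv_def refl_onD)

lemma Con_sym: "\<lbrakk>\<theta> \<in> Con sig A; (x, y) \<in> \<theta>\<rbrakk> \<Longrightarrow> (y, x) \<in> \<theta>"
  by (meson Con_equiv equiv_def symD)

lemma Con_trans: "\<lbrakk>\<theta> \<in> Con sig A; (x, y) \<in> \<theta>; (y, z) \<in> \<theta>\<rbrakk> \<Longrightarrow> (x, z) \<in> \<theta>"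
  by (meson Con_equiv equiv_def transD)

lemma Con_carrier: "\<lbrakk>\<theta> \<in> Con sig A; (x, y) \<in> \<theta>\<rbrakk> \<Longrightarrow> x \<in> carrier A \<and> y \<in> carrier A"
  unfolding Con_def equiv_def by blast

lemma Con_eval:
  assumes "\<theta> \<in> Con sig A" "t \<in> tms sig X" "\<And>x. x \<in> X \<Longrightarrow> (\<rho> x, \<rho>' x) \<in> \<theta>"
  shows "(eval A \<rho> t, eval A \<rho>' t) \<in> \<theta>"
  using assms(2)
proof induction
  case (Op f ts)
  then show ?case
    by (auto simp: list_all2_conv_all_nth intro!: Con_interp[OF assms(1)])
qed (simp add: assms(3))

text \<open>Chains in different arguments of an operation can be run through one argument at a time; this
  is why the transitive closure of the union of two congruences is again a congruence.\<close>

lemma trancl_Un_interp: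
  assumes "is_algebra sig A" "\<beta> \<in> Con sig A" "\<gamma> \<in> Con sig A"
    and "list_all2 (\<lambda>x y. (x, y) \<in> (\<beta> \<union> \<gamma>)\<^sup>+) xs ys"
    and "set pre \<subseteq> carrier A" "sig f = Some (length pre + length xs)"
  shows "(interp A f (pre @ xs), interp A f (pre @ ys)) \<in> (\<beta> \<union> \<gamma>)\<^sup>+"
  using assms(4-6)
proof (induction arbitrary: pre rule: list_all2_induct)
  case Nil
  then have "interp A f pre \<in> carrier A" using assms(1) by (simp add: is_algebra_def)
  then show ?case using Con_refl[OF assms(2)] by auto
next
  case (Cons x xs y ys)
  have sub: "(\<beta> \<union> \<gamma>)\<^sup>+ \<subseteq> carrier A \<times> carrier A"
    by (rule trancl_subset_Sigma) (use assms(2,3) Con_carrier in fast)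
  have xs: "set xs \<subseteq> carrier A"
    using Cons.hyps(2) sub by (fastforce simp: list_all2_conv_all_nth in_set_conv_nth)
  have one: "(interp A f (pre @ x # xs), interp A f (pre @ y # xs)) \<in> \<theta>"
    if "\<theta> \<in> Con sig A" "(x, y) \<in> \<theta>" for \<theta> x y
  proof (rule Con_interp[OF that(1)])
    show "sig f = Some (length (pre @ x # xs))" using Cons.prems by simp
    have "list_all2 (\<lambda>x y. (x, y) \<in> \<theta>) zs zs" if "set zs \<subseteq> carrier A" for zs
      using that Con_refl[OF \<open>\<theta> \<in> Con sig A\<close>] by (auto simp: list_all2_same)
    then show "list_all2 (\<lambda>x y. (x, y) \<in> \<theta>) (pre @ x # xs) (pre @ y # xs)"
      using xs Cons.prems that(2) by (auto intro!: list_all2_appendI)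
  qed
  have "(x, y) \<in> (\<beta> \<union> \<gamma>)\<^sup>+" by fact
  then have "(interp A f (pre @ x # xs), interp A f (pre @ y # xs)) \<in> (\<beta> \<union> \<gamma>)\<^sup>+"
  proof (induction rule: trancl_induct)
    case (base y)
    then show ?case using one assms(2,3) by blast
  next
    case (step y z)
    then have "(interp A f (pre @ y # xs), interp A f (pre @ z # xs)) \<in> \<beta> \<union> \<gamma>"
      using one assms(2,3) by blast
    with step.IH show ?case by (rule trancl_into_trancl)
  qed
  moreover have "(interp A f ((pre @ [y]) @ xs), interp A f ((pre @ [y]) @ ys)) \<in> (\<beta> \<union> \<gamma>)\<^sup>+"
    by (rule Cons.IH) (use Cons.prems Cons.hyps(1) sub in auto)
  ultimately show ?case by (auto intro: trancl_trans)
qed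

lemma trancl_Un_in_Con:
  assumes A: "is_algebra sig A" and \<beta>: "\<beta> \<in> Con sig A" and \<gamma>: "\<gamma> \<in> Con sig A"
  shows "(\<beta> \<union> \<gamma>)\<^sup>+ \<in> Con sig A"
proof -
  have "equiv (carrier A) ((\<beta> \<union> \<gamma>)\<^sup>+)"
  proof (rule equivI)
    show "(\<beta> \<union> \<gamma>)\<^sup>+ \<subseteq> carrier A \<times> carrier A"
      by (rule trancl_subset_Sigma) (use assms(2,3) Con_carrier in fast)
    show "refl_on (carrier A) ((\<beta> \<union> \<gamma>)\<^sup>+)"
      using Con_refl[OF \<beta>] by (auto simp: refl_on_def)
    show "sym ((\<beta> \<union> \<gamma>)\<^sup>+)"
      by (rule sym_trancl) (use Con_sym \<beta> \<gamma> in \<open>fast intro: symI\<close>)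
  qed simp
  then show ?thesis
    using trancl_Un_interp[OF assms, where pre = "[]"] by (auto simp: Con_def)
qed

lemma con_join_subset_trancl:
  assumes "is_algebra sig A" "\<beta> \<in> Con sig A" "\<gamma> \<in> Con sig A"
  shows "con_join sig A \<beta> \<gamma> \<subseteq> (\<beta> \<union> \<gamma>)\<^sup>+"
  using trancl_Un_in_Con[OF assms] by (auto simp: con_join_def)


section \<open>Relatively free algebras\<close>

definition satisfies :: "('f, 'a) algebra \<Rightarrow> ('f, nat) tm \<Rightarrow> ('f, nat) tm \<Rightarrow> bool" where
  "satisfies A s t \<longleftrightarrow> (\<forall>\<rho>. range \<rho> \<subseteq> carrier A \<longrightarrow> eval A \<rho> s = eval A \<rho> t)"

lemma satisfies_refl [simp]: "satisfies A t t"
  by (simp add: satisfies_def)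

lemma satisfies_sym: "satisfies A s t \<Longrightarrow> satisfies A t s"
  by (simp add: satisfies_def)

lemma satisfies_trans: "\<lbrakk>satisfies A s t; satisfies A t r\<rbrakk> \<Longrightarrow> satisfies A s r"
  by (simp add: satisfies_def)

lemma satisfies_Op:
  assumes "list_all2 (satisfies A) ss ts"
  shows "satisfies A (Op f ss) (Op f ts)"
  unfolding satisfies_def
proof (intro allI impI)
  fix \<rho> :: "nat \<Rightarrow> 'b" assume "range \<rho> \<subseteq> carrier A"
  then have "map (eval A \<rho>) ss = map (eval A \<rho>) ts"
    using assms by (intro nth_equalityI) (auto simp: list_all2_conv_all_nth satisfies_def)
  then show "eval A \<rho> (Op f ss) = eval A \<rho> (Op f ts)" by simp
qed

lemma satisfies_tm_subst:
  assumes "is_algebra sig A" "satisfies A s t" "\<And>x. \<sigma> x \<in> tms sig UNIV"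
  shows "satisfies A (tm_subst \<sigma> s) (tm_subst \<sigma> t)"
  unfolding satisfies_def eval_tm_subst
proof (intro allI impI)
  fix \<rho> :: "nat \<Rightarrow> 'b" assume \<rho>: "range \<rho> \<subseteq> carrier A"
  have "range (\<lambda>x. eval A \<rho> (\<sigma> x)) \<subseteq> carrier A"
    using eval_in_carrier[OF assms(1) assms(3)] \<rho> by blast
  then show "eval A (\<lambda>x. eval A \<rho> (\<sigma> x)) s = eval A (\<lambda>x. eval A \<rho> (\<sigma> x)) t"
    using assms(2) unfolding satisfies_def by blast
qed

text \<open>The choice ranges over all terms, including ill-formed ones: the class then depends only on
  validity in \<open>A\<close>. A well-formed representative is recovered by \<open>free_rep\<close> below.\<close>

definition free_class :: "('f, 'a) algebra \<Rightarrow> (('f, nat) tm \<Rightarrow> 'u) \<Rightarrow> ('f, nat) tm \<Rightarrow> 'u" where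
  "free_class A code t = code (SOME s. satisfies A s t)"

definition free_rep ::
  "'f signature \<Rightarrow> ('f, 'a) algebra \<Rightarrow> (('f, nat) tm \<Rightarrow> 'u) \<Rightarrow> 'u \<Rightarrow> ('f, nat) tm" where
  "free_rep sig A code = inv_into (tms sig UNIV) (free_class A code)"

definition free_algebra ::
  "'f signature \<Rightarrow> ('f, 'a) algebra \<Rightarrow> (('f, nat) tm \<Rightarrow> 'u) \<Rightarrow> ('f, 'u) algebra" where
  "free_algebra sig A code =
     \<lparr>carrier = free_class A code ` tms sig UNIV,
      interp = (\<lambda>f us. free_class A code (Op f (map (free_rep sig A code) us)))\<rparr>"

lemma free_class_eq_iff:
  assumes "inj code"
  shows "free_class A code s = free_class A code t \<longleftrightarrow> satisfies A s t"
proof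
  have some: "satisfies A (SOME s. satisfies A s t) t" for t
    by (rule someI[where x = t]) simp
  assume "free_class A code s = free_class A code t"
  then have "(SOME s'. satisfies A s' s) = (SOME s'. satisfies A s' t)"
    using assms by (simp add: free_class_def inj_eq)
  then show "satisfies A s t"
    using some[of s] some[of t] by (metis satisfies_sym satisfies_trans)
next
  assume "satisfies A s t"
  then have "satisfies A r s \<longleftrightarrow> satisfies A r t" for r
    by (meson satisfies_sym satisfies_trans)
  then show "free_class A code s = free_class A code t"
    by (simp add: free_class_def)
qed

lemma free_rep_in_tms:
  "u \<in> carrier (free_algebra sig A code) \<Longrightarrow> free_rep sig A code u \<in> tms sig UNIV"
  unfolding free_rep_def free_algebra_def by (auto intro: inv_into_into)

lemma free_class_rep:
  "u \<in> carrier (free_algebra sig A code) \<Longrightarrow> free_class A code (free_rep sig A code u) = u"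
  unfolding free_rep_def free_algebra_def by (auto intro: f_inv_into_f)

lemma satisfies_free_rep_class:
  assumes "inj code" "t \<in> tms sig UNIV"
  shows "satisfies A (free_rep sig A code (free_class A code t)) t"
proof -
  have "free_class A code t \<in> carrier (free_algebra sig A code)"
    using assms(2) by (simp add: free_algebra_def)
  from free_class_rep[OF this] show ?thesis using free_class_eq_iff[OF assms(1)] by blast
qed

lemma is_algebra_free_algebra: "is_algebra sig (free_algebra sig A code)"
proof -
  have "Var 0 \<in> tms sig UNIV" for sig :: "'f signature" by (rule tms.Var) simp
  then have "carrier (free_algebra sig A code) \<noteq> {}" by (auto simp: free_algebra_def)
  moreover have "interp (free_algebra sig A code) f us \<in> carrier (free_algebra sig A code)"
    if "sig f = Some (length us)" "set us \<subseteq> carrier (free_algebra sig A code)" for f us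
  proof -
    have "Op f (map (free_rep sig A code) us) \<in> tms sig UNIV"
      using that by (auto intro!: tms.Op free_rep_in_tms)
    then show ?thesis by (simp add: free_algebra_def)
  qed
  ultimately show ?thesis by (auto simp: is_algebra_def)
qed

lemma eval_free_algebra:
  assumes "inj code" "t \<in> tms sig UNIV" "\<And>x. \<sigma> x \<in> tms sig UNIV"
  shows "eval (free_algebra sig A code) (\<lambda>x. free_class A code (\<sigma> x)) t
       = free_class A code (tm_subst \<sigma> t)"
  using assms(2)
proof induction
  case (Op f ts)
  let ?q = "free_class A code" and ?r = "free_rep sig A code" and ?F = "free_algebra sig A code"
  have "tm_subst \<sigma> t \<in> tms sig UNIV" if "t \<in> set ts" for t
    using tm_subst_in_tms[OF Op(2)[OF that]] assms(3) by blast
  then have "satisfies A (?r (?q (tm_subst \<sigma> t))) (tm_subst \<sigma> t)" if "t \<in> set ts" for t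
    using that satisfies_free_rep_class[OF assms(1)] by blast
  then have "list_all2 (satisfies A) (map (\<lambda>t. ?r (?q (tm_subst \<sigma> t))) ts) (map (tm_subst \<sigma>) ts)"
    by (auto simp: list_all2_conv_all_nth)
  then have "?q (Op f (map (\<lambda>t. ?r (?q (tm_subst \<sigma> t))) ts)) = ?q (tm_subst \<sigma> (Op f ts))"
    by (simp add: free_class_eq_iff[OF assms(1)] satisfies_Op)
  moreover have "map (eval ?F (\<lambda>x. ?q (\<sigma> x))) ts = map (\<lambda>t. ?q (tm_subst \<sigma> t)) ts"
    using Op.IH by simp
  moreover have "interp ?F f us = ?q (Op f (map ?r us))" for us by (simp add: free_algebra_def)
  ultimately show ?case by (simp only: eval.simps list.map_comp comp_def)
qed simp

text \<open>An identity of \<open>A\<close> holds in the free algebra because the identities of \<open>A\<close> are closed under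
  substitution.\<close>

lemma free_algebra_in_variety:
  assumes "E \<subseteq> identities sig" "inj code" "A \<in> variety sig E"
  shows "free_algebra sig A code \<in> variety sig E"
proof -
  let ?F = "free_algebra sig A code"
  have A: "is_algebra sig A" using assms(3) by (simp add: variety_def)
  have "eval ?F \<rho> s = eval ?F \<rho> t" if st: "(s, t) \<in> E" and \<rho>: "range \<rho> \<subseteq> carrier ?F" for s t \<rho>
  proof -
    define \<sigma> where "\<sigma> x = free_rep sig A code (\<rho> x)" for x
    have \<sigma>: "\<sigma> x \<in> tms sig UNIV" for x
      unfolding \<sigma>_def by (rule free_rep_in_tms[where A = A and code = code]) (use \<rho> in blast)
    have \<rho>_eq: "\<rho> = (\<lambda>x. free_class A code (\<sigma> x))"
      unfolding \<sigma>_def fun_eq_iff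
      by (intro allI free_class_rep[where sig = sig and A = A, symmetric]) (use \<rho> in blast)
    have tms: "s \<in> tms sig UNIV" "t \<in> tms sig UNIV"
      using st assms(1) by (auto simp: identities_def)
    have "satisfies A s t"
      using st assms(3) by (auto simp: variety_def satisfies_def)
    then have "satisfies A (tm_subst \<sigma> s) (tm_subst \<sigma> t)"
      by (rule satisfies_tm_subst[OF A]) (rule \<sigma>)
    then show ?thesis
      unfolding \<rho>_eq
      by (simp add: eval_free_algebra[OF assms(2) tms(1)] eval_free_algebra[OF assms(2) tms(2)] \<sigma>
          free_class_eq_iff[OF assms(2)])
  qed
  then show ?thesis using is_algebra_free_algebra by (auto simp: variety_def)
qed

text \<open>The kernel of the endomorphism of the free algebra that is induced by a substitution.\<close>

definition subst_kernel ::
  "'f signature \<Rightarrow> ('f, 'a) algebra \<Rightarrow> (('f, nat) tm \<Rightarrow> 'u) \<Rightarrow> (nat \<Rightarrow> ('f, nat) tm) \<Rightarrow> 'u rel" where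
  "subst_kernel sig A code \<sigma> =
     {(u, w). u \<in> carrier (free_algebra sig A code) \<and> w \<in> carrier (free_algebra sig A code) \<and>
        satisfies A (tm_subst \<sigma> (free_rep sig A code u)) (tm_subst \<sigma> (free_rep sig A code w))}"

lemma subst_kernel_in_Con:
  assumes "is_algebra sig A" "inj code" "\<And>x. \<sigma> x \<in> tms sig UNIV"
  shows "subst_kernel sig A code \<sigma> \<in> Con sig (free_algebra sig A code)"
proof -
  let ?F = "free_algebra sig A code" and ?K = "subst_kernel sig A code \<sigma>"
    and ?r = "free_rep sig A code"
  have "equiv (carrier ?F) ?K"
    by (rule equivI)
      (auto simp: subst_kernel_def refl_on_def sym_def trans_def
        intro: satisfies_sym satisfies_trans)
  moreover have "(interp ?F f us, interp ?F f ws) \<in> ?K"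
    if f: "sig f = Some (length us)" and K: "list_all2 (\<lambda>u w. (u, w) \<in> ?K) us ws" for f us ws
  proof -
    have len: "length us = length ws" using K by (rule list_all2_lengthD)
    have car: "set us \<subseteq> carrier ?F" "set ws \<subseteq> carrier ?F"
      using K by (auto simp: list_all2_conv_all_nth in_set_conv_nth subst_kernel_def)
    have tms: "Op f (map ?r us) \<in> tms sig UNIV" "Op f (map ?r ws) \<in> tms sig UNIV"
      using car f len by (auto intro!: tms.Op free_rep_in_tms)
    have "list_all2 (satisfies A) (map (tm_subst \<sigma>) (map ?r us)) (map (tm_subst \<sigma>) (map ?r ws))"
      using K by (auto simp: list_all2_conv_all_nth subst_kernel_def)
    then have op: "satisfies A (tm_subst \<sigma> (Op f (map ?r us))) (tm_subst \<sigma> (Op f (map ?r ws)))"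
      by (simp add: satisfies_Op)
    have rep: "satisfies A (tm_subst \<sigma> (?r (free_class A code t))) (tm_subst \<sigma> t)"
      if "t \<in> tms sig UNIV" for t
      by (rule satisfies_tm_subst[OF assms(1) _ assms(3)])
        (rule satisfies_free_rep_class[OF assms(2) that])
    have "interp ?F f us \<in> carrier ?F" "interp ?F f ws \<in> carrier ?F"
      using tms by (auto simp: free_algebra_def)
    then show ?thesis
      using rep[OF tms(1)] rep[OF tms(2)] op
      by (auto simp: subst_kernel_def free_algebra_def intro: satisfies_sym satisfies_trans)
  qed
  ultimately show ?thesis by (simp add: Con_def)
qed

lemma subst_kernel_class_iff:
  assumes "is_algebra sig A" "inj code" "\<And>x. \<sigma> x \<in> tms sig UNIV"
    and "s \<in> tms sig UNIV" "t \<in> tms sig UNIV"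
  shows "(free_class A code s, free_class A code t) \<in> subst_kernel sig A code \<sigma>
    \<longleftrightarrow> satisfies A (tm_subst \<sigma> s) (tm_subst \<sigma> t)"
proof -
  have "satisfies A (tm_subst \<sigma> (free_rep sig A code (free_class A code t))) (tm_subst \<sigma> t)"
    if "t \<in> tms sig UNIV" for t
    by (rule satisfies_tm_subst[OF assms(1) _ assms(3)])
      (rule satisfies_free_rep_class[OF assms(2) that])
  from this[OF assms(4)] this[OF assms(5)] show ?thesis
    using assms(4,5)
    by (auto simp: subst_kernel_def free_algebra_def intro: satisfies_sym satisfies_trans)
qed


section \<open>Jonsson terms\<close>

text \<open>The variables of index at least 2 are all read as the third argument, so that a term in any
  number of variables has a ternary value.\<close>

definition ternary :: "('f, 'a) algebra \<Rightarrow> ('f, nat) tm \<Rightarrow> 'a \<Rightarrow> 'a \<Rightarrow> 'a \<Rightarrow> 'a" where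
  "ternary A t x y z = eval A (\<lambda>i. if i = 0 then x else if i = 1 then y else z) t"

definition Jonsson_candidates :: "'f signature \<Rightarrow> ('f, 'a) algebra \<Rightarrow> ('f, nat) tm set" where
  "Jonsson_candidates sig A =
     {t \<in> tms sig UNIV. \<forall>x\<in>carrier A. \<forall>y\<in>carrier A. ternary A t x y x = x}"

text \<open>A sequence of Jonsson terms is a path from \<open>x\<close> to \<open>z\<close> in this relation, which turns the passage
  along the sequence into an induction over a reflexive transitive closure.\<close>

definition Jonsson_link :: "'f signature \<Rightarrow> ('f, 'a) algebra \<Rightarrow> ('f, nat) tm rel" where
  "Jonsson_link sig A =
     {(s, t). s \<in> Jonsson_candidates sig A \<and> t \<in> Jonsson_candidates sig A \<and>
        ((\<forall>x\<in>carrier A. \<forall>z\<in>carrier A. ternary A s x x z = ternary A t x x z) \<or>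
         (\<forall>x\<in>carrier A. \<forall>z\<in>carrier A. ternary A s x z z = ternary A t x z z))}"

text \<open>For a substitution that identifies two of the three variables, this reads off an identity
  between ternary operations from an identity of \<open>A\<close>.\<close>

lemma satisfies_ternary:
  assumes "satisfies A (tm_subst \<sigma> s) (tm_subst \<sigma> t)"
    and "x \<in> carrier A" "y \<in> carrier A" "z \<in> carrier A"
    and "\<And>i. ternary A (\<sigma> i) x y z = (if i = 0 then x' else if i = 1 then y' else z')"
  shows "ternary A s x' y' z' = ternary A t x' y' z'"
proof -
  have "ternary A (tm_subst \<sigma> r) x y z = ternary A r x' y' z'" for r
    using assms(5) by (simp add: ternary_def eval_tm_subst)
  moreover have "ternary A (tm_subst \<sigma> s) x y z = ternary A (tm_subst \<sigma> t) x y z"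
    using assms(1-4) unfolding satisfies_def ternary_def by (simp add: image_subset_iff)
  ultimately show ?thesis by simp
qed

text \<open>Jonsson's argument, in the free algebra: the kernels \<open>\<alpha>\<close>, \<open>\<beta>\<close>, \<open>\<gamma>\<close> of the endomorphisms that
  identify \<open>x\<close> with \<open>z\<close>, \<open>x\<close> with \<open>y\<close>, and \<open>y\<close> with \<open>z\<close> satisfy \<open>(x, z) \<in> \<alpha> \<inter> (\<beta> \<or> \<gamma>)\<close>. By
  distributivity \<open>x\<close> and \<open>z\<close> are joined by a chain of steps in \<open>\<alpha> \<inter> \<beta>\<close> and \<open>\<alpha> \<inter> \<gamma>\<close>; terms for its
  members are Jonsson terms, since membership in a kernel is an identity of \<open>A\<close>.\<close>

lemma Jonsson_chain:
  fixes A :: "('f, 'a) algebra" and code :: "('f, nat) tm \<Rightarrow> 'u"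
  assumes A: "is_algebra sig A" and code: "inj code"
    and cd: "congruence_distributive sig (free_algebra sig A code)"
  shows "(Var 0, Var 2) \<in> (Jonsson_link sig A)\<^sup>*"
proof -
  let ?F = "free_algebra sig A code" and ?T = "tms sig (UNIV :: nat set)"
  define q where "q = free_class A code"
  define xyx xxz xzz :: "nat \<Rightarrow> ('f, nat) tm"
    where "xyx = (\<lambda>i. Var (if i \<ge> 2 then 0 else i))"
      and "xxz = (\<lambda>i. Var (if i = 1 then 0 else i))"
      and "xzz = (\<lambda>i. Var (if i = 1 then 2 else i))"
  define \<alpha> \<beta> \<gamma>
    where "\<alpha> = subst_kernel sig A code xyx"
      and "\<beta> = subst_kernel sig A code xxz"
      and "\<gamma> = subst_kernel sig A code xzz"
  have var: "Var i \<in> ?T" for i by (rule tms.Var) simp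
  have \<sigma>: "xyx i \<in> ?T" "xxz i \<in> ?T" "xzz i \<in> ?T" for i
    by (simp_all add: xyx_def xxz_def xzz_def var)
  have Con: "\<alpha> \<in> Con sig ?F" "\<beta> \<in> Con sig ?F" "\<gamma> \<in> Con sig ?F"
    unfolding \<alpha>_def \<beta>_def \<gamma>_def by (rule subst_kernel_in_Con[OF A code], rule \<sigma>)+
  have \<alpha>_iff: "(q s, q t) \<in> \<alpha> \<longleftrightarrow> satisfies A (tm_subst xyx s) (tm_subst xyx t)"
    and \<beta>_iff: "(q s, q t) \<in> \<beta> \<longleftrightarrow> satisfies A (tm_subst xxz s) (tm_subst xxz t)"
    and \<gamma>_iff: "(q s, q t) \<in> \<gamma> \<longleftrightarrow> satisfies A (tm_subst xzz s) (tm_subst xzz t)"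
    if "s \<in> ?T" "t \<in> ?T" for s t
    unfolding \<alpha>_def \<beta>_def \<gamma>_def q_def
    by (rule subst_kernel_class_iff[OF A code _ that], rule \<sigma>)+

  have "(q (Var 0), q (Var 2)) \<in> \<alpha>"
    by (simp add: \<alpha>_iff var xyx_def)
  moreover have "(q (Var 0), q (Var 1)) \<in> \<beta>" "(q (Var 1), q (Var 2)) \<in> \<gamma>"
    by (simp_all add: \<beta>_iff \<gamma>_iff var xxz_def xzz_def)
  then have "(q (Var 0), q (Var 2)) \<in> con_join sig ?F \<beta> \<gamma>"
    unfolding con_join_def by (blast intro: Con_trans)
  ultimately have "(q (Var 0), q (Var 2)) \<in> con_join sig ?F (\<alpha> \<inter> \<beta>) (\<alpha> \<inter> \<gamma>)"
    using cd Con unfolding congruence_distributive_def by blast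
  moreover have "\<alpha> \<inter> \<beta> \<in> Con sig ?F" "\<alpha> \<inter> \<gamma> \<in> Con sig ?F"
    using Inter_in_Con[of "{\<alpha>, \<beta>}" sig ?F] Inter_in_Con[of "{\<alpha>, \<gamma>}" sig ?F] Con by auto
  ultimately have chain: "(q (Var 0), q (Var 2)) \<in> (\<alpha> \<inter> \<beta> \<union> \<alpha> \<inter> \<gamma>)\<^sup>+"
    using con_join_subset_trancl[OF is_algebra_free_algebra] by blast

  \<comment> \<open>All members of the chain are \<open>\<alpha>\<close>-related to \<open>x\<close>, which is the identity \<open>t(x, y, x) = x\<close>.\<close>
  have candidate: "t \<in> Jonsson_candidates sig A" if t: "t \<in> ?T" "(q (Var 0), q t) \<in> \<alpha>" for t
  proof -
    have sat: "satisfies A (tm_subst xyx (Var 0)) (tm_subst xyx t)"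
      using t by (simp add: \<alpha>_iff var)
    have "ternary A (Var 0) x y x = ternary A t x y x" if "x \<in> carrier A" "y \<in> carrier A" for x y
      by (rule satisfies_ternary[OF sat, of x y x]) (use that in \<open>auto simp: xyx_def ternary_def\<close>)
    then show ?thesis using t by (simp add: Jonsson_candidates_def ternary_def)
  qed
  have link: "(s, t) \<in> Jonsson_link sig A"
    if st: "s \<in> ?T" "t \<in> ?T" "(q (Var 0), q s) \<in> \<alpha>" "(q s, q t) \<in> \<alpha> \<inter> \<beta> \<union> \<alpha> \<inter> \<gamma>" for s t
  proof -
    have "(q (Var 0), q t) \<in> \<alpha>" using st Con_trans[OF Con(1)] by blast
    then have "s \<in> Jonsson_candidates sig A" "t \<in> Jonsson_candidates sig A"
      using candidate st by blast+
    moreover consider "satisfies A (tm_subst xxz s) (tm_subst xxz t)"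
      | "satisfies A (tm_subst xzz s) (tm_subst xzz t)"
      using st \<beta>_iff \<gamma>_iff by blast
    then have "(\<forall>x\<in>carrier A. \<forall>z\<in>carrier A. ternary A s x x z = ternary A t x x z) \<or>
               (\<forall>x\<in>carrier A. \<forall>z\<in>carrier A. ternary A s x z z = ternary A t x z z)"
    proof cases
      case 1
      have "ternary A s x x z = ternary A t x x z" if "x \<in> carrier A" "z \<in> carrier A" for x z
        by (rule satisfies_ternary[OF 1, of x x z]) (use that in \<open>auto simp: xxz_def ternary_def\<close>)
      then show ?thesis by blast
    next
      case 2
      have "ternary A s x z z = ternary A t x z z" if "x \<in> carrier A" "z \<in> carrier A" for x z
        by (rule satisfies_ternary[OF 2, of x z z]) (use that in \<open>auto simp: xzz_def ternary_def\<close>)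
      then show ?thesis by blast
    qed
    ultimately show ?thesis by (simp add: Jonsson_link_def)
  qed

  have "\<forall>t\<in>?T. q t = w \<longrightarrow> (q (Var 0), w) \<in> \<alpha> \<and> (Var 0, t) \<in> (Jonsson_link sig A)\<^sup>*"
    if "(q (Var 0), w) \<in> (\<alpha> \<inter> \<beta> \<union> \<alpha> \<inter> \<gamma>)\<^sup>+" for w
    using that
  proof (induction rule: trancl_induct)
    case (base w)
    have "(q (Var 0), q (Var 0)) \<in> \<alpha>" by (simp add: \<alpha>_iff var)
    then show ?case using base link[OF var] by blast
  next
    case (step w w')
    have "w \<in> carrier ?F" using step.hyps(2) Con_carrier[OF Con(1)] by blast
    then obtain s where s: "s \<in> ?T" "w = q s" by (auto simp: free_algebra_def q_def)
    then have "(q (Var 0), q s) \<in> \<alpha>" "(Var 0, s) \<in> (Jonsson_link sig A)\<^sup>*"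
      using step.IH by auto
    moreover have "(q s, w') \<in> \<alpha> \<inter> \<beta> \<union> \<alpha> \<inter> \<gamma>" using step.hyps(2) s by simp
    ultimately show ?case
      using link[OF s(1)] Con_trans[OF Con(1)] by (blast intro: rtrancl_into_rtrancl)
  qed
  with chain var show ?thesis by blast
qed

text \<open>Along the path the value at \<open>(c, c, e)\<close> stays in the \<open>\<delta>\<close>-class of \<open>c\<close>: it does not change at a
  link of the first kind, and at a link of the second kind the detour through \<open>(c, e, e)\<close> costs two
  of the given pairs. At the last term, \<open>z\<close>, this value is \<open>e\<close>.\<close>

lemma Jonsson_link_connects:
  assumes chain: "(Var 0, Var 2) \<in> (Jonsson_link sig A)\<^sup>*"
    and \<delta>: "\<delta> \<in> Con sig A" and c: "c \<in> carrier A" and e: "e \<in> carrier A"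
    and steps: "\<And>t. t \<in> Jonsson_candidates sig A \<Longrightarrow> (ternary A t c c e, ternary A t c e e) \<in> \<delta>"
  shows "(c, e) \<in> \<delta>"
proof -
  have "(c, ternary A t c c e) \<in> \<delta>" if "(Var 0, t) \<in> (Jonsson_link sig A)\<^sup>*" for t
    using that
  proof (induction rule: rtrancl_induct)
    case base
    show ?case using Con_refl[OF \<delta> c] by (simp add: ternary_def)
  next
    case (step s t)
    from step.hyps(2) consider "ternary A s c c e = ternary A t c c e"
      | "ternary A s c e e = ternary A t c e e"
      using c e by (auto simp: Jonsson_link_def)
    then show ?case
    proof cases
      case 1
      then show ?thesis using step.IH by simp
    next
      case 2
      have "(ternary A s c c e, ternary A s c e e) \<in> \<delta>" "(ternary A t c c e, ternary A t c e e) \<in> \<delta>"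
        using step.hyps(2) steps by (auto simp: Jonsson_link_def)
      with step.IH 2 show ?thesis by (metis Con_sym[OF \<delta>] Con_trans[OF \<delta>])
    qed
  qed
  from this[OF chain] show ?thesis by (simp add: ternary_def)
qed


section \<open>Cubes spanned by a pair\<close>

definition cube_value ::
  "('f, 'a) algebra \<Rightarrow> 'a \<Rightarrow> 'a \<Rightarrow> ('f, (nat \<times> nat) + 'a) tm \<Rightarrow> nat set \<Rightarrow> 'a" where
  "cube_value A u v p S = poly_value A p (vertex (\<lambda>_. [u]) (\<lambda>_. [v]) S)"

text \<open>The cube has dimension \<open>n + 1\<close>, with directions \<open>0, \<dots>, n\<close>; the edges in question are those in
  direction \<open>n\<close>, and the one over \<open>{..<n}\<close> is the top edge. Triviality is equality in \<open>A\<close>, which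
  keeps the notion independent of the congruence \<open>\<delta>\<close> under consideration.\<close>

definition flat_below_top ::
  "('f, 'a) algebra \<Rightarrow> 'a \<Rightarrow> 'a \<Rightarrow> nat \<Rightarrow> ('f, (nat \<times> nat) + 'a) tm \<Rightarrow> bool" where
  "flat_below_top A u v n p \<longleftrightarrow>
     (\<forall>S. S \<subset> {..<n} \<longrightarrow> cube_value A u v p S = cube_value A u v p (insert n S))"

definition top_edges_in ::
  "'f signature \<Rightarrow> ('f, 'a) algebra \<Rightarrow> 'a \<Rightarrow> 'a \<Rightarrow> nat \<Rightarrow> 'a rel \<Rightarrow> bool" where
  "top_edges_in sig A u v n \<delta> \<longleftrightarrow>
     (\<forall>p \<in> polynomials sig A (Suc n) (\<lambda>_. 1). flat_below_top A u v n p \<longrightarrow>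
        (cube_value A u v p {..<n}, cube_value A u v p (insert n {..<n})) \<in> \<delta>)"

lemma cube_value_in_carrier:
  assumes "is_algebra sig A" "p \<in> polynomials sig A n (\<lambda>_. 1)" "u \<in> carrier A" "v \<in> carrier A"
  shows "cube_value A u v p S \<in> carrier A"
  unfolding cube_value_def
  by (rule poly_value_in_carrier[OF assms(1,2)]) (use assms(3,4) in \<open>auto simp: vertex_def\<close>)

lemma cube_value_tm_subst:
  assumes "p \<in> polynomials sig A n (\<lambda>_. 1)"
    and "\<And>i. i < n \<Longrightarrow> cube_value A u v (\<sigma> (Inl (i, 0))) S = (if i \<in> S' then v else u)"
    and "\<And>c. \<sigma> (Inr c) = Var (Inr c)"
  shows "cube_value A u v (tm_subst \<sigma> p) S = cube_value A u v p S'"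
  unfolding cube_value_def poly_value_def eval_tm_subst
  by (rule eval_cong_tms[OF assms(1)[unfolded polynomials_def]])
    (use assms(2,3) in \<open>auto simp: cube_value_def poly_value_def vertex_def\<close>)

lemma cube_value_restrict:
  assumes "p \<in> polynomials sig A n (\<lambda>_. 1)" "S \<inter> {..<n} = S' \<inter> {..<n}"
  shows "cube_value A u v p S = cube_value A u v p S'"
  unfolding cube_value_def poly_value_def
proof (rule eval_cong_tms[OF assms(1)[unfolded polynomials_def]])
  have "i \<in> S \<longleftrightarrow> i \<in> S'" if "i < n" for i using that assms(2) by blast
  then show "case_sum (\<lambda>(i, j). vertex (\<lambda>_. [u]) (\<lambda>_. [v]) S i ! j) (\<lambda>c. c) x
      = case_sum (\<lambda>(i, j). vertex (\<lambda>_. [u]) (\<lambda>_. [v]) S' i ! j) (\<lambda>c. c) x"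
    if "x \<in> Inl ` {(i, j). i < n \<and> j < 1} \<union> Inr ` carrier A" for x
    using that by (auto simp: vertex_def)
qed

text \<open>The new polynomial is \<open>t\<close> applied to three copies of \<open>p\<close> that differ in the argument of direction
  \<open>n\<close>: the constant \<open>u\<close>, the variable of the new direction \<open>n + 1\<close>, and the old variable. The identity
  \<open>t(x, y, x) = x\<close> is what makes the new cube flat.\<close>

lemma raise_dimension:
  assumes p: "p \<in> polynomials sig A (Suc n) (\<lambda>_. 1)" and flat: "flat_below_top A u v n p"
    and t: "t \<in> Jonsson_candidates sig A"
    and A: "is_algebra sig A" and u: "u \<in> carrier A" and v: "v \<in> carrier A"
  defines "c \<equiv> cube_value A u v p {..<n}" and "e \<equiv> cube_value A u v p (insert n {..<n})"
  shows "\<exists>g \<in> polynomials sig A (Suc (Suc n)) (\<lambda>_. 1). flat_below_top A u v (Suc n) g \<and>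
    cube_value A u v g {..<Suc n} = ternary A t c c e \<and>
    cube_value A u v g (insert (Suc n) {..<Suc n}) = ternary A t c e e"
proof -
  let ?val = "cube_value A u v"
  define at_u to_new :: "(nat \<times> nat) + 'b \<Rightarrow> ('a, (nat \<times> nat) + 'b) tm"
    where "at_u x = (if x = Inl (n, 0) then Var (Inr u) else Var x)"
      and "to_new x = (if x = Inl (n, 0) then Var (Inl (Suc n, 0)) else Var x)" for x
  define g where "g = tm_subst (\<lambda>i. if i = 0 then tm_subst at_u p
      else if i = 1 then tm_subst to_new p else p) t"
  have p': "tm_subst at_u p \<in> polynomials sig A (Suc (Suc n)) (\<lambda>_. 1)"
    "tm_subst to_new p \<in> polynomials sig A (Suc (Suc n)) (\<lambda>_. 1)"
    unfolding polynomials_def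
    by (rule tm_subst_in_tms[OF p[unfolded polynomials_def]];
        use u in \<open>auto simp: at_u_def to_new_def intro!: tms.Var\<close>)+
  have "tm_subst Var p \<in> polynomials sig A (Suc (Suc n)) (\<lambda>_. 1)"
    unfolding polynomials_def
    by (rule tm_subst_in_tms[OF p[unfolded polynomials_def]]) (auto intro!: tms.Var)
  moreover have "tm_subst Var q = q" for q :: "('a, (nat \<times> nat) + 'b) tm"
    by (induction q) (simp_all add: map_idI)
  ultimately have "g \<in> polynomials sig A (Suc (Suc n)) (\<lambda>_. 1)"
    using t p' unfolding g_def polynomials_def
    by (intro tm_subst_in_tms[where X = UNIV]) (auto simp: Jonsson_candidates_def)
  have at_u: "?val (tm_subst at_u p) S = ?val p (S - {n})" for S
    by (rule cube_value_tm_subst[OF p])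
      (auto simp: at_u_def cube_value_def poly_value_def vertex_def)
  have to_new: "?val (tm_subst to_new p) S = ?val p (if Suc n \<in> S then insert n S else S - {n})" for S
    by (rule cube_value_tm_subst[OF p])
      (auto simp: to_new_def cube_value_def poly_value_def vertex_def)
  have "?val g S = ternary A t (?val (tm_subst at_u p) S) (?val (tm_subst to_new p) S) (?val p S)" for S
    unfolding g_def cube_value_def poly_value_def eval_tm_subst[where t = t] ternary_def
    by (rule arg_cong[where f = "\<lambda>\<rho>. eval A \<rho> t"]) auto
  then have g: "?val g S = ternary A t (?val p (S - {n}))
      (?val p (if Suc n \<in> S then insert n S else S - {n})) (?val p S)" for S
    by (simp add: at_u to_new)
  have restrict: "?val p S = ?val p S'" if "S \<inter> {..<Suc n} = S' \<inter> {..<Suc n}" for S S'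
    using cube_value_restrict[OF p that] .
  have idem: "ternary A t (?val p S) (?val p S') (?val p S) = ?val p S" for S S'
    using t cube_value_in_carrier[OF A p u v] by (simp add: Jonsson_candidates_def)

  \<comment> \<open>Flatness: either only the choice in direction \<open>n\<close> is \<open>u\<close>, and the outer arguments of \<open>t\<close> agree,
    or an earlier choice is \<open>u\<close>, and flatness of \<open>p\<close> makes all three arguments agree.\<close>
  have "?val g S = ?val g (insert (Suc n) S)" if S: "S \<subset> {..<Suc n}" for S
  proof (cases "{..<n} \<subseteq> S")
    case True
    then have "S = {..<n}" using S by (auto simp: lessThan_Suc)
    then have "?val p (S - {n}) = ?val p S" "?val p (insert (Suc n) S) = ?val p S"
      "?val p (insert (Suc n) S - {n}) = ?val p S"
      by (auto intro!: restrict)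
    then show ?thesis unfolding g by (simp add: idem)
  next
    case False
    then have "S - {n} \<subset> {..<n}" using S by (auto simp: lessThan_Suc)
    then have "?val p (S - {n}) = ?val p (insert n S)"
      using flat by (simp add: flat_below_top_def)
    moreover have "?val p (insert (Suc n) S - {n}) = ?val p (S - {n})"
      "?val p (insert n (insert (Suc n) S)) = ?val p (insert n S)"
      "?val p (insert (Suc n) S) = ?val p S" "Suc n \<notin> S"
      using S by (auto intro!: restrict)
    ultimately show ?thesis unfolding g by simp
  qed
  then have "flat_below_top A u v (Suc n) g" by (simp add: flat_below_top_def)
  moreover have "?val g {..<Suc n} = ternary A t c c e"
  proof -
    have "{..<Suc n} - {n} = {..<n}" by auto
    then show ?thesis unfolding g c_def e_def by (simp add: lessThan_Suc)
  qed
  moreover have "?val g (insert (Suc n) {..<Suc n}) = ternary A t c e e"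
  proof -
    have "?val p (insert (Suc n) {..<Suc n} - {n}) = c"
      "?val p (insert n (insert (Suc n) {..<Suc n})) = e" "?val p (insert (Suc n) {..<Suc n}) = e"
      unfolding c_def e_def by (auto intro!: restrict)
    then show ?thesis unfolding g by simp
  qed
  ultimately show ?thesis using \<open>g \<in> _\<close> by blast
qed

lemma top_edges_in_lower:
  assumes "top_edges_in sig A u v (Suc n) \<delta>"
    and chain: "(Var 0, Var 2) \<in> (Jonsson_link sig A)\<^sup>*"
    and A: "is_algebra sig A" and \<delta>: "\<delta> \<in> Con sig A" and u: "u \<in> carrier A" and v: "v \<in> carrier A"
  shows "top_edges_in sig A u v n \<delta>"
  unfolding top_edges_in_def
proof (intro ballI impI)
  fix p assume p: "p \<in> polynomials sig A (Suc n) (\<lambda>_. 1)" and flat: "flat_below_top A u v n p"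
  show "(cube_value A u v p {..<n}, cube_value A u v p (insert n {..<n})) \<in> \<delta>"
    by (rule Jonsson_link_connects[OF chain \<delta>])
      (use raise_dimension[OF p flat _ A u v] assms(1) cube_value_in_carrier[OF A p u v] in
        \<open>force simp: top_edges_in_def\<close>)+
qed

lemma top_edges_in_imp_pair:
  assumes "top_edges_in sig A u v n \<delta>"
    and "(Var 0, Var 2) \<in> (Jonsson_link sig A)\<^sup>*"
    and "is_algebra sig A" "\<delta> \<in> Con sig A" "u \<in> carrier A" "v \<in> carrier A"
  shows "(u, v) \<in> \<delta>"
  using assms(1)
proof (induction n)
  case 0
  let ?p = "Var (Inl (0, 0))"
  have "?p \<in> polynomials sig A (Suc 0) (\<lambda>_. 1)"
    unfolding polynomials_def by (rule tms.Var) auto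
  moreover have "flat_below_top A u v 0 ?p" by (simp add: flat_below_top_def)
  ultimately have "(cube_value A u v ?p {..<0}, cube_value A u v ?p (insert 0 {..<0})) \<in> \<delta>"
    using 0 unfolding top_edges_in_def by blast
  then show ?case by (simp add: cube_value_def poly_value_def vertex_def)
next
  case (Suc n)
  show ?case by (rule Suc.IH, rule top_edges_in_lower[OF Suc.prems assms(2-6)])
qed


section \<open>Neutrality\<close>

lemma centralizes_imp_Inter_subset:
  assumes A: "is_algebra sig A" and chain: "(Var 0, Var 2) \<in> (Jonsson_link sig A)\<^sup>*"
    and \<alpha>s: "set \<alpha>s \<subseteq> Con sig A" "\<alpha>s \<noteq> []"
    and \<delta>: "\<delta> \<in> Con sig A" "centralizes sig A \<alpha>s \<delta>"
  shows "\<Inter> (set \<alpha>s) \<subseteq> \<delta>"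
proof (rule subrelI)
  fix u v assume uv: "(u, v) \<in> \<Inter> (set \<alpha>s)"
  obtain n where n: "length \<alpha>s = Suc n" using \<alpha>s(2) by (cases \<alpha>s) auto
  have car: "u \<in> carrier A" "v \<in> carrier A"
    using uv \<alpha>s Con_carrier[of "hd \<alpha>s"] hd_in_set[OF \<alpha>s(2)] by blast+
  have "top_edges_in sig A u v n \<delta>"
    unfolding top_edges_in_def
  proof (intro ballI impI)
    fix p assume p: "p \<in> polynomials sig A (Suc n) (\<lambda>_. 1)" and flat: "flat_below_top A u v n p"
    have "\<forall>i<length \<alpha>s. list_all2 (\<lambda>x y. (x, y) \<in> \<alpha>s ! i) [u] [v]"
      using uv by simp
    moreover have "\<forall>S. S \<subset> {..<n} \<longrightarrow>
        (cube_value A u v p S, cube_value A u v p (insert n S)) \<in> \<delta>"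
      using flat cube_value_in_carrier[OF A p car] Con_refl[OF \<delta>(1)]
      by (auto simp: flat_below_top_def)
    ultimately show "(cube_value A u v p {..<n}, cube_value A u v p (insert n {..<n})) \<in> \<delta>"
      using \<delta>(2)[unfolded centralizes_def Let_def n, rule_format, of "\<lambda>_. [u]" "\<lambda>_. [v]" p] p n
      by (simp add: cube_value_def)
  qed
  then show "(u, v) \<in> \<delta>"
    by (rule top_edges_in_imp_pair[OF _ chain A \<delta>(1) car])
qed

text \<open>Modulo \<open>\<theta> = \<alpha>\<^sub>j\<close> the choice in block \<open>j\<close> does not matter. If \<open>j\<close> is the last block, this settles the
  top edge directly; otherwise undoing choice \<open>j\<close> at both ends moves the top edge to one of the edges
  of the hypothesis.\<close>

lemma centralizes_Inter_set:
  assumes \<alpha>s: "set \<alpha>s \<subseteq> Con sig A"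
  shows "centralizes sig A \<alpha>s (\<Inter> (set \<alpha>s))"
  unfolding centralizes_def Let_def
proof (intro allI impI ballI InterI)
  fix a b p \<theta>
  assume ab: "\<forall>i<length \<alpha>s. list_all2 (\<lambda>x y. (x, y) \<in> \<alpha>s ! i) (a i) (b i)"
    and p: "p \<in> polynomials sig A (length \<alpha>s) (\<lambda>i. length (a i))"
    and S: "\<forall>S\<subset>{..<length \<alpha>s - 1}. (poly_value A p (vertex a b S),
           poly_value A p (vertex a b (insert (length \<alpha>s - 1) S))) \<in> \<Inter> (set \<alpha>s)"
    and \<theta>: "\<theta> \<in> set \<alpha>s"
  let ?m = "length \<alpha>s - 1" and ?val = "\<lambda>S. poly_value A p (vertex a b S)"
  obtain j where j: "j < length \<alpha>s" "\<theta> = \<alpha>s ! j" using \<theta> by (metis in_set_conv_nth)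
  have Con: "\<theta> \<in> Con sig A" using \<theta> \<alpha>s by blast
  have in_carrier: "a i ! k \<in> carrier A \<and> b i ! k \<in> carrier A"
    if "i < length \<alpha>s" "k < length (a i)" for i k
  proof -
    have "\<alpha>s ! i \<in> Con sig A" using that \<alpha>s by auto
    then show ?thesis
      using ab that Con_carrier by (fastforce simp: list_all2_conv_all_nth)
  qed
  have move: "(?val (S - {j}), ?val (insert j S)) \<in> \<theta>" for S
    unfolding poly_value_def
  proof (rule Con_eval[OF Con p[unfolded polynomials_def]])
    fix x assume "x \<in> Inl ` {(i, k). i < length \<alpha>s \<and> k < length (a i)} \<union> Inr ` carrier A"
    then show "(case_sum (\<lambda>(i, k). vertex a b (S - {j}) i ! k) (\<lambda>c. c) x,
        case_sum (\<lambda>(i, k). vertex a b (insert j S) i ! k) (\<lambda>c. c) x) \<in> \<theta>"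
      using ab j in_carrier Con_refl[OF Con]
      by (auto simp: vertex_def list_all2_conv_all_nth)
  qed
  show "(?val {..<?m}, ?val (insert ?m {..<?m})) \<in> \<theta>"
  proof (cases "j = ?m")
    case True
    then show ?thesis using move[of "{..<?m}"] by simp
  next
    case False
    then have "j < ?m" using j by simp
    let ?S = "{..<?m} - {j}"
    have "(?val ?S, ?val {..<?m}) \<in> \<theta>"
      using move[of "{..<?m}"] \<open>j < ?m\<close> by (simp add: insert_absorb)
    moreover have "(?val (insert ?m ?S), ?val (insert ?m {..<?m})) \<in> \<theta>"
      using move[of "insert ?m {..<?m}"] \<open>j < ?m\<close>
      by (simp add: insert_absorb insert_Diff_if split: if_splits)
    moreover have "?S \<subset> {..<?m}" using \<open>j < ?m\<close> by auto
    then have "(?val ?S, ?val (insert ?m ?S)) \<in> \<theta>" using S \<theta> by blast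
    ultimately show ?thesis by (meson Con_sym[OF Con] Con_trans[OF Con])
  qed
qed

theorem theorem4p15:
  fixes sig :: "'f signature"
    and E :: "(('f, nat) tm \<times> ('f, nat) tm) set"
    and code :: "('f, nat) tm \<Rightarrow> 'u"
  assumes "E \<subseteq> identities sig"
    and "inj code"
    and "\<forall>A \<in> (variety sig E :: ('f, 'u) algebra set). congruence_distributive sig A"
  shows "\<forall>n\<ge>2. \<forall>A \<in> (variety sig E :: ('f, 'a) algebra set). commutator_neutral sig n A"
  unfolding commutator_neutral_def
proof (intro allI impI ballI)
  fix n A \<alpha>s
  assume "2 \<le> n" and AV: "A \<in> (variety sig E :: ('f, 'a) algebra set)"
    and "length \<alpha>s = n \<and> set \<alpha>s \<subseteq> Con sig A"
  then have A: "is_algebra sig A" and \<alpha>s: "set \<alpha>s \<subseteq> Con sig A" "\<alpha>s \<noteq> []"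
    by (auto simp: variety_def)
  have "congruence_distributive sig (free_algebra sig A code)"
    using assms(3) free_algebra_in_variety[OF assms(1,2) AV] by blast
  then have chain: "(Var 0, Var 2) \<in> (Jonsson_link sig A)\<^sup>*"
    by (rule Jonsson_chain[OF A assms(2)])
  show "higher_commutator sig A \<alpha>s = \<Inter> (set \<alpha>s)"
  proof
    have "\<Inter> (set \<alpha>s) \<in> Con sig A" using \<alpha>s by (intro Inter_in_Con) auto
    then show "higher_commutator sig A \<alpha>s \<subseteq> \<Inter> (set \<alpha>s)"
      using higher_commutator_is_least(3)[OF A \<alpha>s(1)] centralizes_Inter_set[OF \<alpha>s(1)] by blast
    show "\<Inter> (set \<alpha>s) \<subseteq> higher_commutator sig A \<alpha>s"
      using centralizes_imp_Inter_subset[OF A chain \<alpha>s]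
        higher_commutator_is_least(1,2)[OF A \<alpha>s(1)] by blast
  qed
qed

end
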